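(* The competitive ratio of any randomized preemptive online algorithm for the maximum cardinality matching problem is at least $1+\ln 2$. That is, if $C\ge 1$ and there is a randomized preemptive online algorithm that, for every finite input sequence $\sigma$ of edges of a finite simple undirected graph, ends with a matching of expected cardinality at least $\mathrm{OPT}(\sigma)/C$, where $\mathrm{OPT}(\sigma)$ is the maximum cardinality of a matching in the graph formed by all edges of $\sigma$, then $C\ge 1+\ln 2$.
   Context: Preemptive online maximum cardinality matching: the edges of a finite simple undirected graph are presented one after the other, in an order chosen by the adversary, and the algorithm has no knowledge of future edges (or of when the sequence ends). The algorithm maintains a set $M$ of presented edges, initially empty, which must be a matching at all times. When an edge $e$ is presented, the algorithm may remove (preempt) any edges from $M$, and must immediately decide whether to add $e$ to $M$; adding $e$ is allowed only if the resulting set is a matching. An edge that is rejected on arrival, or is removed from $M$ later on, can never be (re-)inserted. Decisions may depend only on the edges presented so far and, for a randomized algorithm, on internal random bits; the input sequence is fixed in advance, independently of these random bits (oblivious adversary). The output is the matching $M$ held after the last edge is presented, and the objective is to maximize $|M|$. The competitive ratio of a randomized algorithm is the infimum of all $C\ge 1$ such that $\mathbb{E}[|M|]\ge \mathrm{OPT}(\sigma)/C$ for every input sequence $\sigma$. *)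

theory Defs
  imports "HOL-Probability.Probability"
begin

text \<open>
  An edge of a simple undirected graph is a two-element set of vertices. An input is the list of
  the edges of a finite simple graph in order of arrival, so no edge occurs twice.
\<close>

definition edge_sequence :: "'v set list \<Rightarrow> bool" where
  "edge_sequence \<sigma> \<longleftrightarrow> distinct \<sigma> \<and> (\<forall>e\<in>set \<sigma>. card e = 2)"

definition matching :: "'v set set \<Rightarrow> bool" where
  "matching N \<longleftrightarrow> pairwise disjnt N"

definition OPT :: "'v set list \<Rightarrow> nat" where
  "OPT \<sigma> = Max {card N |N. N \<subseteq> set \<sigma> \<and> matching N}"

text \<open>
  A deterministic algorithm is the function \<open>B\<close> mapping the sequence of edges presented so far to
  the set of edges held after the last of them has been processed. The inclusion says that a step
  may discard any edges and insert at most the edge being presented. As the edges of a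
  sequence are distinct, an edge that was rejected or preempted is never inserted again.
\<close>

definition preemptive_online_algorithm :: "('v set list \<Rightarrow> 'v set set) \<Rightarrow> bool" where
  "preemptive_online_algorithm B \<longleftrightarrow>
     B [] = {} \<and>
     (\<forall>\<sigma> e. edge_sequence (\<sigma> @ [e]) \<longrightarrow> B (\<sigma> @ [e]) \<subseteq> insert e (B \<sigma>)) \<and>
     (\<forall>\<sigma>. edge_sequence \<sigma> \<longrightarrow> matching (B \<sigma>))"

text \<open>
  The internal randomness is the outcome \<open>\<omega>\<close> of an arbitrary probability space \<open>M\<close>; once it is
  fixed, the algorithm is deterministic. The inputs \<open>\<sigma>\<close> do not depend on \<open>\<omega>\<close> (oblivious adversary).
\<close>

definition randomized_preemptive_online_algorithm ::
    "'r measure \<Rightarrow> ('r \<Rightarrow> 'v set list \<Rightarrow> 'v set set) \<Rightarrow> bool" where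
  "randomized_preemptive_online_algorithm M A \<longleftrightarrow>
     prob_space M \<and>
     (\<forall>\<omega>\<in>space M. preemptive_online_algorithm (A \<omega>)) \<and>
     (\<forall>\<sigma>. edge_sequence \<sigma> \<longrightarrow> (\<lambda>\<omega>. A \<omega> \<sigma>) \<in> measurable M (count_space UNIV))"

definition competitive ::
    "'r measure \<Rightarrow> ('r \<Rightarrow> 'v set list \<Rightarrow> 'v set set) \<Rightarrow> real \<Rightarrow> bool" where
  "competitive M A C \<longleftrightarrow>
     (\<forall>\<sigma>. edge_sequence \<sigma> \<longrightarrow> (\<integral>\<omega>. real (card (A \<omega> \<sigma>)) \<partial>M) \<ge> real (OPT \<sigma>) / C)"

text \<open>Extended reals, so that the ratio is \<open>\<infinity>\<close> if the algorithm is not competitive for any \<open>C\<close>.\<close>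

definition competitive_ratio ::
    "'r measure \<Rightarrow> ('r \<Rightarrow> 'v set list \<Rightarrow> 'v set set) \<Rightarrow> ereal" where
  "competitive_ratio M A = Inf {ereal C |C. C \<ge> 1 \<and> competitive M A C}"

end

theory Submission
  imports Defs "HOL-Real_Asymp.Real_Asymp"
begin

text \<open>
  The adversary builds layers. A stage starts with \<open>n\<close> vertices \<open>U\<close>, loaded by edges to the previous
  layer, and \<open>2n\<close> fresh vertices \<open>V\<close>. One after the other, a random \<open>u \<in> U\<close> is joined to all living
  vertices of \<open>V\<close>, and then a random \<open>v\<close> of these dies; the optimum uses \<open>uv\<close>. The \<open>n\<close> survivors are
  the set \<open>U\<close> of the next stage. If every \<open>u\<close> has load \<open>p\<close> at the start, a stage gains at most
  \<open>(1 - p) n\<close>, while the optimum grows by \<open>n\<close>. The gain is spread evenly over \<open>2n, \<dots>, n + 1\<close> living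
  vertices, so each survivor ends up with load \<open>(1 - p) H\<close> where
  \<open>H = 1/(n+1) + \<dots> + 1/(2n) \<approx> ln 2\<close>. In the steady state \<open>p = (1 - p) H\<close>, that is,
  \<open>1 - p = 1/(1 + H)\<close>.

  That the algorithm cannot do better by holding back or by preempting follows from LP duality: with
  \<open>\<kappa> = n/(1 + H)\<close>, the expected size of its matching minus suitably weighted loads of the living
  vertices grows by at most \<open>\<kappa>\<close> in each stage. By averaging, the random choices can be replaced by
  choices depending on the marginal probabilities of the algorithm only.
\<close>

section \<open>Living vertices and their weights\<close>

lemma finite_edge: "edge_sequence \<sigma> \<Longrightarrow> e \<in> set \<sigma> \<Longrightarrow> finite e"
  by (metis card.infinite edge_sequence_def zero_neq_numeral)

text \<open>
  All other vertices will get no further edges. The matching of size \<open>t\<close> is the optimum planned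
  by the adversary on these vertices.
\<close>

definition live :: "nat set list \<Rightarrow> nat set \<Rightarrow> nat set \<Rightarrow> nat \<Rightarrow> bool" where
  "live \<sigma> U V t \<longleftrightarrow> edge_sequence \<sigma> \<and> finite U \<and> finite V \<and> U \<inter> V = {} \<and>
     (\<forall>e\<in>set \<sigma>. card (e \<inter> (U \<union> V)) \<le> 1) \<and>
     (\<exists>N\<subseteq>set \<sigma>. matching N \<and> card N = t \<and> \<Union>N \<inter> (U \<union> V) = {})"

text \<open>Only one endpoint of an old edge is alive, so it pays for at most one weight. This makes
  the coefficients \<open>1 - sum a e\<close> of old edges nonnegative, so that a drop of
  \<open>y\<close> can only lower the potential.\<close>

lemma sum_live_le_1:
  fixes f :: "'a \<Rightarrow> real"
  assumes "finite e" "card (e \<inter> S) \<le> 1"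
    and "\<And>x. f x \<le> 1" "\<And>x. x \<notin> S \<Longrightarrow> f x = 0"
  shows "sum f e \<le> 1"
proof -
  have "sum f e = sum f (e \<inter> S)"
    using assms by (intro sum.mono_neutral_right) auto
  also have "\<dots> \<le> (\<Sum>x\<in>e \<inter> S. 1)" using assms by (intro sum_mono) auto
  also have "\<dots> \<le> 1" using assms(2) by simp
  finally show ?thesis .
qed

definition weight :: "real \<Rightarrow> nat set \<Rightarrow> real \<Rightarrow> nat set \<Rightarrow> nat \<Rightarrow> real" where
  "weight b U g V x = b * of_bool (x \<in> U) + g * of_bool (x \<in> V)"

text \<open>
  The weight of the \<open>m\<close> vertices of \<open>U\<close> when \<open>n + m\<close> vertices of \<open>V\<close> are alive (junk value \<open>0\<close> at
  \<open>m = 0\<close>, where \<open>U\<close> is empty).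
\<close>

definition average_gain :: "real \<Rightarrow> nat \<Rightarrow> nat \<Rightarrow> real" where
  "average_gain \<kappa> n m = (\<Sum>i=1..m. 1 - \<kappa> / real (n + i)) / real m"

lemma average_gain_le_1: "0 \<le> \<kappa> \<Longrightarrow> average_gain \<kappa> n m \<le> 1"
proof -
  assume "0 \<le> \<kappa>"
  hence "(\<Sum>i=1..m. 1 - \<kappa> / real (n + i)) \<le> (\<Sum>i=1..m. 1)" by (intro sum_mono) simp
  thus ?thesis by (cases "m = 0") (auto simp: average_gain_def divide_simps)
qed

lemma mult_average_gain: "real m * average_gain \<kappa> n m = (\<Sum>i=1..m. 1 - \<kappa> / real (n + i))"
  by (simp add: average_gain_def)

section \<open>Edge probabilities and the potential\<close>

text \<open>
  \<open>y \<sigma> e\<close> is the probability that \<open>e\<close> is held after \<open>\<sigma>\<close>.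
\<close>

locale fractional_algorithm =
  fixes y :: "nat set list \<Rightarrow> nat set \<Rightarrow> real"
  assumes decreasing: "edge_sequence (\<sigma> @ \<tau>) \<Longrightarrow> e \<in> set \<sigma> \<Longrightarrow> y (\<sigma> @ \<tau>) e \<le> y \<sigma> e"
    and load_le_1: "edge_sequence \<sigma> \<Longrightarrow> (\<Sum>e | e \<in> set \<sigma> \<and> x \<in> e. y \<sigma> e) \<le> 1"
begin

text \<open>Exchanging the sums gives the expected matching size minus the sum over \<open>x\<close>
  of \<open>a x\<close> times the load of \<open>x\<close>; the weights act as dual prices.\<close>

definition potential :: "nat set list \<Rightarrow> (nat \<Rightarrow> real) \<Rightarrow> real" where
  "potential \<sigma> a = (\<Sum>e\<in>set \<sigma>. y \<sigma> e * (1 - sum a e))"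

text \<open>
  The potential is affine in the weights, so a vertex at random can be replaced by a best one.
\<close>

lemma potential_le_average:
  assumes "finite I" "I \<noteq> {}" and avg: "\<And>x. (\<Sum>i\<in>I. a' i x) = real (card I) * a x"
  shows "\<exists>i\<in>I. potential \<sigma> (a' i) \<le> potential \<sigma> a"
proof (rule ccontr)
  assume "\<not> ?thesis"
  hence "(\<Sum>i\<in>I. potential \<sigma> a) < (\<Sum>i\<in>I. potential \<sigma> (a' i))"
    using assms by (intro sum_strict_mono) auto
  also have "\<dots> = (\<Sum>e\<in>set \<sigma>. \<Sum>i\<in>I. y \<sigma> e * (1 - sum (a' i) e))"
    unfolding potential_def by (rule sum.swap)
  also have "\<dots> = (\<Sum>e\<in>set \<sigma>. real (card I) * (y \<sigma> e * (1 - sum a e)))"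
  proof (rule sum.cong[OF refl])
    fix e
    have "(\<Sum>i\<in>I. sum (a' i) e) = real (card I) * sum a e"
      by (subst sum.swap) (simp add: avg sum_distrib_left)
    thus "(\<Sum>i\<in>I. y \<sigma> e * (1 - sum (a' i) e)) = real (card I) * (y \<sigma> e * (1 - sum a e))"
      by (simp add: sum_distrib_left[symmetric] sum_subtractf algebra_simps)
  qed
  also have "\<dots> = (\<Sum>i\<in>I. potential \<sigma> a)"
    by (simp add: potential_def sum_distrib_left)
  finally show False by simp
qed

section \<open>The adversary: one star, one stage, a chain of stages\<close>

text \<open>
  The bound \<open>1\<close> on the load of \<open>u\<close> is shared by its old edges and the new ones. The former are charged
  the weight \<open>1 - g\<close> at \<open>u\<close>, so that both have coefficient \<open>1 - g\<close> in the difference of potentials.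
\<close>

lemma star:
  assumes live: "live \<sigma> U V t" and u: "u \<in> U" and g: "0 \<le> g" "g \<le> 1" and b: "b \<le> 1"
  obtains \<sigma>' where "edge_sequence \<sigma>'" "set \<sigma>' = set \<sigma> \<union> (\<lambda>v. {u, v}) ` V"
    "potential \<sigma>' (weight b (U - {u}) g V)
       \<le> potential \<sigma> (\<lambda>x. weight b (U - {u}) g V x + (1 - g) * of_bool (x = u)) + (1 - g)"
proof -
  from live have es: "edge_sequence \<sigma>" and fin: "finite U" "finite V" and disj: "U \<inter> V = {}"
    and old: "\<And>e. e \<in> set \<sigma> \<Longrightarrow> card (e \<inter> (U \<union> V)) \<le> 1"
    by (auto simp: live_def)
  note fin_e = finite_edge[OF es]
  obtain vs where vs: "set vs = V" "distinct vs"
    using fin finite_distinct_list by blast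
  define \<tau> where "\<tau> = map (\<lambda>v. {u, v}) vs"
  have set_\<tau>: "set \<tau> = (\<lambda>v. {u, v}) ` V" by (simp add: \<tau>_def vs)
  have uV: "u \<notin> V" using u disj by auto
  have inj: "inj_on (\<lambda>v. {u, v}) V" by (auto simp: inj_on_def doubleton_eq_iff)
  have fresh: "{u, v} \<notin> set \<sigma>" if "v \<in> V" for v
  proof
    assume "{u, v} \<in> set \<sigma>"
    moreover have "{u, v} \<inter> (U \<union> V) = {u, v}" using u that by auto
    moreover have "u \<noteq> v" using uV that by auto
    ultimately show False using old[of "{u, v}"] by simp
  qed
  have es': "edge_sequence (\<sigma> @ \<tau>)"
    unfolding edge_sequence_def
  proof
    show "distinct (\<sigma> @ \<tau>)"
      using es vs inj fresh by (auto simp: edge_sequence_def set_\<tau>) (auto simp: \<tau>_def distinct_map)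
    show "\<forall>e\<in>set (\<sigma> @ \<tau>). card e = 2"
      using es uV by (auto simp: edge_sequence_def set_\<tau> card_2_iff)
  qed
  define a where "a = weight b (U - {u}) g V"
  define a' where "a' = (\<lambda>x. a x + (1 - g) * of_bool (x = u))"
  let ?y = "y (\<sigma> @ \<tau>)"
  have a'_sum: "sum a' e = sum a e + (1 - g) * of_bool (u \<in> e)" if "e \<in> set \<sigma>" for e
    using fin_e[OF that] by (simp add: a'_def sum.distrib sum_distrib_left[symmetric] of_bool_def)
  have disj\<tau>: "set \<sigma> \<inter> set \<tau> = {}" using fresh by (auto simp: set_\<tau>)
  have "potential (\<sigma> @ \<tau>) a
      = (\<Sum>e\<in>set \<sigma>. ?y e * (1 - sum a e)) + (\<Sum>e\<in>set \<tau>. ?y e * (1 - sum a e))"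
    unfolding potential_def using disj\<tau> by (simp add: sum.union_disjoint)
  \<comment> \<open>In the weights \<open>a\<close>, \<open>u\<close> has already left
    \<open>U\<close>, so a new edge pays only \<open>g\<close>, at its end in
    \<open>V\<close>.\<close>
  also have "(\<Sum>e\<in>set \<tau>. ?y e * (1 - sum a e)) = (\<Sum>e\<in>set \<tau>. (1 - g) * ?y e)"
  proof (rule sum.cong[OF refl])
    fix e assume "e \<in> set \<tau>"
    then obtain v where "v \<in> V" "e = {u, v}" "u \<noteq> v" using uV by (auto simp: set_\<tau>)
    thus "?y e * (1 - sum a e) = (1 - g) * ?y e"
      using uV disj by (auto simp: a_def weight_def)
  qed
  also have "(\<Sum>e\<in>set \<sigma>. ?y e * (1 - sum a e))
      = (\<Sum>e\<in>set \<sigma>. ?y e * (1 - sum a' e)) + (\<Sum>e\<in>set \<sigma>. (1 - g) * (?y e * of_bool (u \<in> e)))"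
    unfolding sum.distrib[symmetric] by (rule sum.cong) (auto simp: a'_sum algebra_simps)
  also have "(\<Sum>e\<in>set \<sigma>. ?y e * (1 - sum a' e)) \<le> potential \<sigma> a'"
    unfolding potential_def
  proof (rule sum_mono)
    fix e assume e: "e \<in> set \<sigma>"
    have "sum a' e \<le> 1"
      using fin_e[OF e] old[OF e]
      by (rule sum_live_le_1) (use u uV disj g b in \<open>auto simp: a'_def a_def weight_def\<close>)
    thus "?y e * (1 - sum a' e) \<le> y \<sigma> e * (1 - sum a' e)"
      using decreasing[OF es' e] by (intro mult_right_mono) auto
  qed
  finally have "potential (\<sigma> @ \<tau>) a
      \<le> potential \<sigma> a' + (1 - g) * ((\<Sum>e\<in>set \<sigma>. ?y e * of_bool (u \<in> e)) + (\<Sum>e\<in>set \<tau>. ?y e))"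
    by (simp only: sum_distrib_left distrib_left add.assoc)
  also have "(\<Sum>e\<in>set \<sigma>. ?y e * of_bool (u \<in> e)) + (\<Sum>e\<in>set \<tau>. ?y e)
      = (\<Sum>e\<in>set (\<sigma> @ \<tau>). ?y e * of_bool (u \<in> e))"
  proof -
    have "(\<Sum>e\<in>set \<tau>. ?y e) = (\<Sum>e\<in>set \<tau>. ?y e * of_bool (u \<in> e))"
      by (rule sum.cong) (auto simp: set_\<tau>)
    thus ?thesis using disj\<tau> by (simp only: set_append sum.union_disjoint finite_set)
  qed
  also have "\<dots> = (\<Sum>e | e \<in> set (\<sigma> @ \<tau>) \<and> u \<in> e. ?y e)"
    by (rule sum.mono_neutral_cong_right) auto
  also have "\<dots> \<le> 1" by (rule load_le_1[OF es'])
  finally have "potential (\<sigma> @ \<tau>) a \<le> potential \<sigma> a' + (1 - g)"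
    using g by (simp add: mult_left_mono)
  with es' show ?thesis
    by (intro that[of "\<sigma> @ \<tau>"]) (auto simp: set_\<tau> a_def a'_def)
qed

text \<open>Two averagings around \<open>star\<close>. Over \<open>u\<close>, hypothesis
  \<open>b\<close> says exactly that the weights on its right-hand side average to \<open>b\<close>
  on \<open>U\<close>. Over \<open>v\<close>, the total weight \<open>\<kappa>\<close> of
  \<open>V\<close> is kept: each vertex has weight \<open>\<kappa> / N\<close> for \<open>N\<close>
  of the \<open>Suc N\<close> choices and 0 for the other one, on average
  \<open>\<kappa> / Suc N\<close>.\<close>

lemma step:
  fixes \<kappa> b b' :: real
  assumes live: "live \<sigma> U V t" and card: "card U = Suc m" "card V = Suc N" and N: "0 < N"
    and \<kappa>: "0 \<le> \<kappa>" "\<kappa> \<le> Suc N" and b': "b' \<le> 1"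
    and b: "real (Suc m) * b = real m * b' + (1 - \<kappa> / Suc N)"
  obtains \<sigma>' u v where "u \<in> U" "v \<in> V" "live \<sigma>' (U - {u}) (V - {v}) (Suc t)"
    "potential \<sigma>' (weight b' (U - {u}) (\<kappa> / N) (V - {v}))
       \<le> potential \<sigma> (weight b U (\<kappa> / Suc N) V) + (1 - \<kappa> / Suc N)"
proof -
  define g where "g = \<kappa> / Suc N"
  have g: "0 \<le> g" "g \<le> 1" using \<kappa> by (auto simp: g_def)
  from live have fin: "finite U" "finite V" and disj: "U \<inter> V = {}" by (auto simp: live_def)
  have "\<exists>u\<in>U. potential \<sigma> (\<lambda>x. weight b' (U - {u}) g V x + (1 - g) * of_bool (x = u))
          \<le> potential \<sigma> (weight b U g V)"
  proof (rule potential_le_average)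
    fix x
    show "(\<Sum>u\<in>U. weight b' (U - {u}) g V x + (1 - g) * of_bool (x = u))
        = real (card U) * weight b U g V x"
    proof (cases "x \<in> U")
      case True
      have "(\<Sum>u\<in>U. weight b' (U - {u}) g V x + (1 - g) * of_bool (x = u))
          = (\<Sum>u\<in>U. if u = x then 1 - g else b')"
        using True disj by (intro sum.cong) (auto simp: weight_def)
      also have "\<dots> = (1 - g) + real m * b'"
        using True fin card by (simp add: sum.remove[of U x])
      finally show ?thesis using True b card disj by (auto simp: weight_def g_def)
    next
      case False
      have "(\<Sum>u\<in>U. weight b' (U - {u}) g V x + (1 - g) * of_bool (x = u))
          = (\<Sum>u\<in>U. g * of_bool (x \<in> V))"
        using False by (intro sum.cong) (auto simp: weight_def)
      thus ?thesis using False by (simp add: weight_def)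
    qed
  qed (use fin card in auto)
  then obtain u where u: "u \<in> U" and pot_u:
    "potential \<sigma> (\<lambda>x. weight b' (U - {u}) g V x + (1 - g) * of_bool (x = u))
       \<le> potential \<sigma> (weight b U g V)" by blast
  obtain \<sigma>' where es': "edge_sequence \<sigma>'" and set': "set \<sigma>' = set \<sigma> \<union> (\<lambda>v. {u, v}) ` V"
    and pot': "potential \<sigma>' (weight b' (U - {u}) g V)
       \<le> potential \<sigma> (\<lambda>x. weight b' (U - {u}) g V x + (1 - g) * of_bool (x = u)) + (1 - g)"
    using star[OF live u g b'] .
  have "\<exists>v\<in>V. potential \<sigma>' (weight b' (U - {u}) (\<kappa> / N) (V - {v}))
          \<le> potential \<sigma>' (weight b' (U - {u}) g V)"
  proof (rule potential_le_average)
    fix x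
    show "(\<Sum>v\<in>V. weight b' (U - {u}) (\<kappa> / N) (V - {v}) x)
        = real (card V) * weight b' (U - {u}) g V x"
    proof (cases "x \<in> V")
      case True
      have "(\<Sum>v\<in>V. weight b' (U - {u}) (\<kappa> / N) (V - {v}) x)
          = (\<Sum>v\<in>V. if v = x then 0 else \<kappa> / N)"
        using True disj by (intro sum.cong) (auto simp: weight_def)
      also have "\<dots> = \<kappa>"
        using True fin card N by (simp add: sum.remove[of V x])
      finally show ?thesis using True card disj by (auto simp: weight_def g_def)
    next
      case False
      have "(\<Sum>v\<in>V. weight b' (U - {u}) (\<kappa> / N) (V - {v}) x)
          = (\<Sum>v\<in>V. b' * of_bool (x \<in> U - {u}))"
        using False by (intro sum.cong) (auto simp: weight_def)
      thus ?thesis using False by (simp add: weight_def)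
    qed
  qed (use fin card in auto)
  then obtain v where v: "v \<in> V" and pot_v:
    "potential \<sigma>' (weight b' (U - {u}) (\<kappa> / N) (V - {v}))
       \<le> potential \<sigma>' (weight b' (U - {u}) g V)" by blast
  have "live \<sigma>' (U - {u}) (V - {v}) (Suc t)"
    unfolding live_def
  proof (intro conjI ballI)
    fix e assume "e \<in> set \<sigma>'"
    then consider "e \<in> set \<sigma>" | w where "w \<in> V" "e = {u, w}" by (auto simp: set')
    thus "card (e \<inter> (U - {u} \<union> (V - {v}))) \<le> 1"
    proof cases
      case 1
      hence "card (e \<inter> (U \<union> V)) \<le> 1" using live by (auto simp: live_def)
      moreover have "card (e \<inter> (U - {u} \<union> (V - {v}))) \<le> card (e \<inter> (U \<union> V))"
        using fin by (intro card_mono) auto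
      ultimately show ?thesis by simp
    next
      case 2
      have "card (e \<inter> (U - {u} \<union> (V - {v}))) \<le> card {w}"
        using 2 u disj by (intro card_mono) auto
      thus ?thesis by simp
    qed
  next
    obtain M where M: "M \<subseteq> set \<sigma>" "matching M" "card M = t" "\<Union>M \<inter> (U \<union> V) = {}"
      using live by (auto simp: live_def)
    have uvM: "{u, v} \<inter> \<Union>M = {}" using M u v by auto
    show "\<exists>M\<subseteq>set \<sigma>'. matching M \<and> card M = Suc t \<and> \<Union>M \<inter> (U - {u} \<union> (V - {v})) = {}"
    proof (intro exI conjI)
      \<comment> \<open>Both endpoints were alive, hence untouched by \<open>M\<close>, and both die
        now.\<close>
      show "insert {u, v} M \<subseteq> set \<sigma>'" using M v by (auto simp: set')
      show "matching (insert {u, v} M)"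
        using M uvM unfolding matching_def pairwise_insert disjnt_def by blast
      have "{u, v} \<notin> M" using uvM by auto
      thus "card (insert {u, v} M) = Suc t"
        using M finite_subset[OF M(1)] by simp
      show "\<Union>(insert {u, v} M) \<inter> (U - {u} \<union> (V - {v})) = {}"
        using M u v disj by blast
    qed
  qed (use es' fin disj in auto)
  with u v show ?thesis
    using pot_u pot' pot_v by (intro that[of u v \<sigma>']) (auto simp: g_def)
qed

text \<open>\<open>average_gain\<close> solves the recursion that \<open>step\<close> imposes on the
  weight of \<open>U\<close>, so the steps can be iterated until \<open>U\<close> is used up, and
  their gains add up.\<close>

lemma stage:
  assumes "live \<sigma> U V t" "card U = m" "card V = n + m" and n: "0 < n"
    and \<kappa>: "0 \<le> \<kappa>" "\<kappa> \<le> n"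
  shows "\<exists>\<sigma>' V'. live \<sigma>' {} V' (t + m) \<and> card V' = n \<and>
    potential \<sigma>' (weight 0 {} (\<kappa> / n) V')
      \<le> potential \<sigma> (weight (average_gain \<kappa> n m) U (\<kappa> / real (n + m)) V)
        + (\<Sum>i=1..m. 1 - \<kappa> / real (n + i))"
  using assms(1-3)
proof (induction m arbitrary: \<sigma> U V t)
  case 0
  hence "U = {}" by (auto simp: live_def)
  hence "weight 0 {} (\<kappa> / n) V = weight (average_gain \<kappa> n 0) U (\<kappa> / (n + 0)) V"
    by (auto simp: weight_def fun_eq_iff)
  with 0 \<open>U = {}\<close> show ?case by (intro exI[of _ \<sigma>] exI[of _ V]) auto
next
  case (Suc m)
  have "real (Suc m) * average_gain \<kappa> n (Suc m)
      = real m * average_gain \<kappa> n m + (1 - \<kappa> / Suc (n + m))"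
    unfolding mult_average_gain by (simp add: algebra_simps)
  moreover have "card V = Suc (n + m)" using Suc.prems by simp
  ultimately obtain \<sigma>' u v where uv: "u \<in> U" "v \<in> V"
    and live': "live \<sigma>' (U - {u}) (V - {v}) (Suc t)"
    and pot: "potential \<sigma>' (weight (average_gain \<kappa> n m) (U - {u}) (\<kappa> / real (n + m)) (V - {v}))
       \<le> potential \<sigma> (weight (average_gain \<kappa> n (Suc m)) U (\<kappa> / Suc (n + m)) V)
         + (1 - \<kappa> / Suc (n + m))"
    using step[OF Suc.prems(1,2), of "n + m" \<kappa> "average_gain \<kappa> n m" "average_gain \<kappa> n (Suc m)"]
      n \<kappa> average_gain_le_1[of \<kappa> n m] by (smt (verit) add_gr_0 of_nat_Suc of_nat_add of_nat_0_le_iff)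
  have "card (U - {u}) = m" "card (V - {v}) = n + m"
    using Suc.prems uv by (auto simp: live_def)
  from Suc.IH[OF live' this] obtain \<sigma>'' V'' where
    "live \<sigma>'' {} V'' (Suc t + m)" "card V'' = n"
    "potential \<sigma>'' (weight 0 {} (\<kappa> / n) V'')
      \<le> potential \<sigma>' (weight (average_gain \<kappa> n m) (U - {u}) (\<kappa> / real (n + m)) (V - {v}))
        + (\<Sum>i=1..m. 1 - \<kappa> / real (n + i))" by blast
  with pot show ?case
    by (intro exI[of _ \<sigma>''] exI[of _ V'']) (auto simp: algebra_simps)
qed

text \<open>By \<open>fixpoint\<close>, \<open>average_gain \<kappa> n n\<close> equals
  \<open>\<kappa> / n\<close>: the weight of the survivors of one stage is the weight with which the
  next stage has to start. So stages can be concatenated, each adding at most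
  \<open>\<kappa>\<close> to the potential.\<close>

lemma chain:
  assumes n: "0 < n" and \<kappa>: "0 \<le> \<kappa>" "\<kappa> \<le> n" and fixpoint: "(\<Sum>i=1..n. 1 - \<kappa> / real (n + i)) = \<kappa>"
  shows "\<exists>\<sigma> U. live \<sigma> {} U (k * n) \<and> card U = n \<and>
    potential \<sigma> (weight 0 {} (\<kappa> / n) U) \<le> real k * \<kappa>"
proof (induction k)
  case 0
  have "live [] {} {..<n} 0"
    by (auto simp: live_def edge_sequence_def matching_def)
  thus ?case by (intro exI[of _ "[]"] exI[of _ "{..<n}"]) (auto simp: potential_def)
next
  case (Suc k)
  then obtain \<sigma> U where live: "live \<sigma> {} U (k * n)" and U: "card U = n"
    and pot: "potential \<sigma> (weight 0 {} (\<kappa> / n) U) \<le> real k * \<kappa>" by blast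
  have es: "edge_sequence \<sigma>" and finU: "finite U" using live by (auto simp: live_def)
  note fin_e = finite_edge[OF es]
  \<comment> \<open>Fresh vertices are always available because the vertices are the natural
    numbers.\<close>
  have "infinite (UNIV - (\<Union>(set \<sigma>) \<union> U))"
    using finU fin_e by (intro Diff_infinite_finite) auto
  then obtain V where V: "finite V" "card V = n + n" "V \<subseteq> UNIV - (\<Union>(set \<sigma>) \<union> U)"
    using infinite_arbitrarily_large by blast
  have eV: "e \<inter> V = {}" if "e \<in> set \<sigma>" for e using V that by auto
  have "live \<sigma> U V (k * n)"
    unfolding live_def
  proof (intro conjI ballI)
    fix e assume e: "e \<in> set \<sigma>"
    have "e \<inter> (U \<union> V) = e \<inter> ({} \<union> U)" using eV[OF e] by auto
    thus "card (e \<inter> (U \<union> V)) \<le> 1" using live e by (simp add: live_def)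
  next
    obtain M where M: "M \<subseteq> set \<sigma>" "matching M" "card M = k * n" "\<Union>M \<inter> ({} \<union> U) = {}"
      using live by (auto simp: live_def)
    moreover have "\<Union>M \<inter> V = {}" using M(1) eV by blast
    ultimately show "\<exists>M\<subseteq>set \<sigma>. matching M \<and> card M = k * n \<and> \<Union>M \<inter> (U \<union> V) = {}" by blast
  qed (use es finU V in auto)
  from stage[OF this U V(2) n \<kappa>] fixpoint obtain \<sigma>' V' where
    "live \<sigma>' {} V' (k * n + n)" "card V' = n" and pot':
    "potential \<sigma>' (weight 0 {} (\<kappa> / n) V')
      \<le> potential \<sigma> (weight (average_gain \<kappa> n n) U (\<kappa> / real (n + n)) V) + \<kappa>" by auto
  \<comment> \<open>The fresh vertices lie on no edge of \<open>\<sigma>\<close>, so giving them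
    weight does not change the potential.\<close>
  moreover have "potential \<sigma> (weight (average_gain \<kappa> n n) U (\<kappa> / real (n + n)) V)
      = potential \<sigma> (weight 0 {} (\<kappa> / n) U)"
    unfolding potential_def
  proof (intro sum.cong refl arg_cong[of _ _ "\<lambda>z. _ * (1 - z)"])
    fix e x assume "e \<in> set \<sigma>" "x \<in> e"
    with eV show "weight (average_gain \<kappa> n n) U (\<kappa> / real (n + n)) V x = weight 0 {} (\<kappa> / n) U x"
      using fixpoint by (auto simp: weight_def average_gain_def)
  qed
  ultimately show ?case using pot
    by (intro exI[of _ \<sigma>'] exI[of _ V']) (auto simp: algebra_simps)
qed

text \<open>The potential falls short of the expected size by \<open>\<kappa> / n\<close> times the
  loads of \<open>n\<close> survivors. These loads are at most 1, so the loss is at most one further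
  \<open>\<kappa>\<close>; hence \<open>Suc k\<close>.\<close>

lemma hard_sequence:
  assumes n: "0 < n" and \<kappa>: "0 \<le> \<kappa>" "\<kappa> \<le> n" and fixpoint: "(\<Sum>i=1..n. 1 - \<kappa> / real (n + i)) = \<kappa>"
  shows "\<exists>\<sigma>. edge_sequence \<sigma> \<and> (\<exists>N\<subseteq>set \<sigma>. matching N \<and> card N = k * n) \<and>
    (\<Sum>e\<in>set \<sigma>. y \<sigma> e) \<le> real (Suc k) * \<kappa>"
proof -
  obtain \<sigma> U where live: "live \<sigma> {} U (k * n)" and U: "card U = n"
    and pot: "potential \<sigma> (weight 0 {} (\<kappa> / n) U) \<le> real k * \<kappa>"
    using chain[OF assms] by blast
  have es: "edge_sequence \<sigma>" and finU: "finite U" using live by (auto simp: live_def)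
  note fin_e = finite_edge[OF es]
  have "(\<Sum>e\<in>set \<sigma>. y \<sigma> e * sum (weight 0 {} (\<kappa> / n) U) e)
      = (\<Sum>e\<in>set \<sigma>. \<Sum>x\<in>U. \<kappa> / n * (y \<sigma> e * of_bool (x \<in> e)))"
  proof (rule sum.cong[OF refl])
    fix e assume e: "e \<in> set \<sigma>"
    have "sum (weight 0 {} (\<kappa> / n) U) e = (\<Sum>x\<in>e \<inter> U. \<kappa> / n)"
      using fin_e[OF e] by (intro sum.mono_neutral_cong_right) (auto simp: weight_def)
    also have "\<dots> = (\<Sum>x\<in>U. \<kappa> / n * of_bool (x \<in> e))"
      using finU by (intro sum.mono_neutral_cong_left) auto
    finally show "y \<sigma> e * sum (weight 0 {} (\<kappa> / n) U) e
        = (\<Sum>x\<in>U. \<kappa> / n * (y \<sigma> e * of_bool (x \<in> e)))"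
      by (simp add: sum_distrib_left algebra_simps)
  qed
  also have "\<dots> = (\<Sum>x\<in>U. \<kappa> / n * (\<Sum>e\<in>set \<sigma>. y \<sigma> e * of_bool (x \<in> e)))"
    by (subst sum.swap) (simp only: sum_distrib_left)
  also have "\<dots> \<le> (\<Sum>x\<in>U. \<kappa> / n * 1)"
  proof (intro sum_mono mult_left_mono)
    fix x
    have "(\<Sum>e\<in>set \<sigma>. y \<sigma> e * of_bool (x \<in> e)) = (\<Sum>e | e \<in> set \<sigma> \<and> x \<in> e. y \<sigma> e)"
      by (rule sum.mono_neutral_cong_right) auto
    thus "(\<Sum>e\<in>set \<sigma>. y \<sigma> e * of_bool (x \<in> e)) \<le> 1" using load_le_1[OF es] by simp
  qed (use \<kappa> in auto)
  also have "\<dots> = \<kappa>" using U n by simp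
  finally have "(\<Sum>e\<in>set \<sigma>. y \<sigma> e) - \<kappa> \<le> potential \<sigma> (weight 0 {} (\<kappa> / n) U)"
    by (simp add: potential_def algebra_simps sum_subtractf)
  with pot have "(\<Sum>e\<in>set \<sigma>. y \<sigma> e) \<le> real (Suc k) * \<kappa>" by (simp add: algebra_simps)
  with live es show ?thesis by (auto simp: live_def)
qed

end

section \<open>From randomized algorithms to edge probabilities\<close>

lemma subset_edges:
  assumes "preemptive_online_algorithm B" "edge_sequence \<sigma>"
  shows "B \<sigma> \<subseteq> set \<sigma>"
  using assms(2)
proof (induction \<sigma> rule: rev_induct)
  case Nil
  thus ?case using assms(1) by (simp add: preemptive_online_algorithm_def)
next
  case (snoc e \<sigma>)
  have "B (\<sigma> @ [e]) \<subseteq> insert e (B \<sigma>)"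
    using assms(1) snoc.prems by (simp add: preemptive_online_algorithm_def)
  moreover have "edge_sequence \<sigma>" using snoc.prems by (auto simp: edge_sequence_def)
  ultimately show ?case using snoc.IH by auto
qed

text \<open>Since edges are distinct, an edge of \<open>\<sigma>\<close> is not presented again
  during \<open>\<tau>\<close> and cannot return once lost. This yields \<open>decreasing\<close>
  for \<open>edge_prob\<close>.\<close>

lemma old_edges_decreasing:
  assumes "preemptive_online_algorithm B" "edge_sequence (\<sigma> @ \<tau>)"
  shows "B (\<sigma> @ \<tau>) \<inter> set \<sigma> \<subseteq> B \<sigma>"
  using assms(2)
proof (induction \<tau> rule: rev_induct)
  case (snoc e \<tau>)
  have "edge_sequence ((\<sigma> @ \<tau>) @ [e])" using snoc.prems by simp
  hence "B ((\<sigma> @ \<tau>) @ [e]) \<subseteq> insert e (B (\<sigma> @ \<tau>))"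
    using assms(1) unfolding preemptive_online_algorithm_def by blast
  moreover have "edge_sequence (\<sigma> @ \<tau>)" "e \<notin> set \<sigma>"
    using snoc.prems by (auto simp: edge_sequence_def)
  ultimately show ?case using snoc.IH by auto
qed auto

lemma card_matching_at_vertex:
  assumes "finite N" "matching N"
  shows "card {e \<in> N. x \<in> e} \<le> 1"
  using assms by (auto simp: card_le_Suc0_iff_eq matching_def pairwise_def disjnt_def)

lemma matching_le_OPT:
  assumes "N \<subseteq> set \<sigma>" "matching N"
  shows "card N \<le> OPT \<sigma>"
proof -
  have "{card N |N. N \<subseteq> set \<sigma> \<and> matching N} \<subseteq> card ` Pow (set \<sigma>)" by auto
  hence "finite {card N |N. N \<subseteq> set \<sigma> \<and> matching N}" by (rule finite_subset) simp
  thus ?thesis unfolding OPT_def using assms by (intro Max_ge) auto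
qed

context
  fixes M :: "'r measure" and A :: "'r \<Rightarrow> nat set list \<Rightarrow> nat set set"
  assumes alg: "randomized_preemptive_online_algorithm M A"
begin

definition edge_prob :: "nat set list \<Rightarrow> nat set \<Rightarrow> real" where
  "edge_prob \<sigma> e = measure M {\<omega> \<in> space M. e \<in> A \<omega> \<sigma>}"

lemma sets_edge_event: "edge_sequence \<sigma> \<Longrightarrow> {\<omega> \<in> space M. e \<in> A \<omega> \<sigma>} \<in> sets M"
proof -
  assume "edge_sequence \<sigma>"
  hence "(\<lambda>\<omega>. A \<omega> \<sigma>) \<in> measurable M (count_space UNIV)"
    using alg by (simp add: randomized_preemptive_online_algorithm_def)
  from measurable_sets[OF this, of "{N. e \<in> N}"] show ?thesis
    by (simp add: vimage_def Int_def conj_commute)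
qed

text \<open>Linearity of expectation. It is applied to all edges for the expected size and to the
  edges at a vertex for its load.\<close>

lemma sum_edge_prob:
  assumes "edge_sequence \<sigma>" "E \<subseteq> set \<sigma>"
  shows "(\<Sum>e\<in>E. edge_prob \<sigma> e) = (\<integral>\<omega>. real (card (A \<omega> \<sigma> \<inter> E)) \<partial>M)"
proof -
  interpret prob_space M using alg by (simp add: randomized_preemptive_online_algorithm_def)
  have fin: "finite E" using assms(2) by (rule finite_subset) simp
  have "(\<Sum>e\<in>E. edge_prob \<sigma> e) = (\<Sum>e\<in>E. \<integral>\<omega>. indicator {\<omega> \<in> space M. e \<in> A \<omega> \<sigma>} \<omega> \<partial>M)"
    using sets_edge_event[OF assms(1)] by (simp add: edge_prob_def)
  also have "\<dots> = (\<integral>\<omega>. (\<Sum>e\<in>E. indicator {\<omega> \<in> space M. e \<in> A \<omega> \<sigma>} \<omega>) \<partial>M)"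
    using sets_edge_event[OF assms(1)]
    by (intro Bochner_Integration.integral_sum[symmetric])
      (simp add: integrable_indicator_iff less_top[symmetric])
  also have "\<dots> = (\<integral>\<omega>. real (card (A \<omega> \<sigma> \<inter> E)) \<partial>M)"
  proof (rule Bochner_Integration.integral_cong[OF refl])
    fix \<omega> assume "\<omega> \<in> space M"
    hence "(\<Sum>e\<in>E. indicator {\<omega> \<in> space M. e \<in> A \<omega> \<sigma>} \<omega>) = (\<Sum>e\<in>A \<omega> \<sigma> \<inter> E. 1 :: real)"
      using fin by (intro sum.mono_neutral_cong_right) (auto simp: indicator_def)
    thus "(\<Sum>e\<in>E. indicator {\<omega> \<in> space M. e \<in> A \<omega> \<sigma>} \<omega>) = real (card (A \<omega> \<sigma> \<inter> E))"
      by simp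
  qed
  finally show ?thesis .
qed

lemma fractional_algorithm_edge_prob: "fractional_algorithm edge_prob"
proof
  interpret prob_space M using alg by (simp add: randomized_preemptive_online_algorithm_def)
  have det: "preemptive_online_algorithm (A \<omega>)" if "\<omega> \<in> space M" for \<omega>
    using alg that by (simp add: randomized_preemptive_online_algorithm_def)
  show "edge_prob (\<sigma> @ \<tau>) e \<le> edge_prob \<sigma> e"
    if "edge_sequence (\<sigma> @ \<tau>)" "e \<in> set \<sigma>" for \<sigma> \<tau> e
  proof -
    have "edge_sequence \<sigma>" using that(1) by (simp add: edge_sequence_def)
    thus ?thesis unfolding edge_prob_def
      using old_edges_decreasing[OF det that(1)] that(2)
      by (intro finite_measure_mono sets_edge_event) auto
  qed
  show "(\<Sum>e | e \<in> set \<sigma> \<and> x \<in> e. edge_prob \<sigma> e) \<le> 1" if es: "edge_sequence \<sigma>" for \<sigma> x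
  proof -
    have "(\<Sum>e | e \<in> set \<sigma> \<and> x \<in> e. edge_prob \<sigma> e)
        = (\<integral>\<omega>. real (card (A \<omega> \<sigma> \<inter> {e. e \<in> set \<sigma> \<and> x \<in> e})) \<partial>M)"
      by (rule sum_edge_prob[OF es]) auto
    also have "\<dots> \<le> (\<integral>\<omega>. 1 \<partial>M)"
    proof (rule integral_mono')
      fix \<omega> assume \<omega>: "\<omega> \<in> space M"
      have sub: "A \<omega> \<sigma> \<subseteq> set \<sigma>" by (rule subset_edges[OF det[OF \<omega>] es])
      hence "A \<omega> \<sigma> \<inter> {e. e \<in> set \<sigma> \<and> x \<in> e} = {e \<in> A \<omega> \<sigma>. x \<in> e}" by auto
      moreover have "matching (A \<omega> \<sigma>)"
        using det[OF \<omega>] es by (simp add: preemptive_online_algorithm_def)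
      ultimately show "real (card (A \<omega> \<sigma> \<inter> {e. e \<in> set \<sigma> \<and> x \<in> e})) \<le> 1"
        using card_matching_at_vertex[of "A \<omega> \<sigma>" x] finite_subset[OF sub] by simp
    qed auto
    finally show ?thesis by (simp add: prob_space)
  qed
qed

lemma competitive_bound:
  assumes C: "1 \<le> C" "competitive M A C" and n: "0 < n"
  shows "(1 + (\<Sum>i=1..n. 1 / real (n + i))) * (real n / real (Suc n)) \<le> C"
proof -
  define H where "H = (\<Sum>i=1..n. 1 / real (n + i))"
  \<comment> \<open>The solution of \<open>n - \<kappa> * H = \<kappa>\<close>, the steady
    state.\<close>
  define \<kappa> where "\<kappa> = real n / (1 + H)"
  have H: "0 \<le> H" unfolding H_def by (intro sum_nonneg) auto
  have \<kappa>: "0 \<le> \<kappa>" "\<kappa> \<le> n" using H by (auto simp: \<kappa>_def divide_simps algebra_simps)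
  have "(\<Sum>i=1..n. 1 - \<kappa> / real (n + i)) = real n - \<kappa> * H"
    by (simp add: H_def sum_subtractf sum_distrib_left)
  also have "\<dots> = \<kappa>" using H by (simp add: \<kappa>_def field_simps)
  finally have fixpoint: "(\<Sum>i=1..n. 1 - \<kappa> / real (n + i)) = \<kappa>" .
  \<comment> \<open>Taking \<open>n\<close> stages makes the extra \<open>\<kappa>\<close>
    negligible: the optimum is at least \<open>n * n\<close>, the algorithm gets at most
    \<open>Suc n * \<kappa>\<close>, and the loss factor \<open>n / Suc n\<close> tends to
    1.\<close>
  obtain \<sigma> N where es: "edge_sequence \<sigma>" and N: "N \<subseteq> set \<sigma>" "matching N" "card N = n * n"
    and le: "(\<Sum>e\<in>set \<sigma>. edge_prob \<sigma> e) \<le> real (Suc n) * \<kappa>"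
    using fractional_algorithm.hard_sequence[OF fractional_algorithm_edge_prob n \<kappa> fixpoint, of n]
    by blast
  have "real n * real n / C \<le> real (OPT \<sigma>) / C"
    using matching_le_OPT[OF N(1,2)] N(3) C(1)
    by (intro divide_right_mono) (simp_all flip: of_nat_mult)
  also have "\<dots> \<le> (\<integral>\<omega>. real (card (A \<omega> \<sigma>)) \<partial>M)"
    using C(2) es by (simp add: competitive_def)
  also have "\<dots> = (\<integral>\<omega>. real (card (A \<omega> \<sigma> \<inter> set \<sigma>)) \<partial>M)"
  proof (rule Bochner_Integration.integral_cong[OF refl])
    fix \<omega> assume "\<omega> \<in> space M"
    hence "A \<omega> \<sigma> \<subseteq> set \<sigma>"
      using alg es by (intro subset_edges) (auto simp: randomized_preemptive_online_algorithm_def)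
    thus "real (card (A \<omega> \<sigma>)) = real (card (A \<omega> \<sigma> \<inter> set \<sigma>))" by (simp add: Int_absorb2)
  qed
  also have "\<dots> = (\<Sum>e\<in>set \<sigma>. edge_prob \<sigma> e)" by (simp add: sum_edge_prob[OF es])
  also note le
  finally have "real n * real n / C \<le> real (Suc n) * (real n / (1 + H))" by (simp add: \<kappa>_def)
  hence "real n * (real n / C) \<le> real n * (real (Suc n) / (1 + H))" by (simp add: mult.commute)
  hence "real n / C \<le> real (Suc n) / (1 + H)"
    using n by (simp only: mult_le_cancel_left_pos of_nat_0_less_iff)
  thus ?thesis unfolding H_def[symmetric] using C(1) H n by (simp add: field_simps)
qed

end

section \<open>The limit of the bounds\<close>

text \<open>The logarithm telescopes, and \<open>ln x \<le> x - 1\<close> bounds each increment by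
  the matching term of the sum.\<close>

lemma harmonic_block_ge: "(\<Sum>i=1..m. 1 / real (n + i)) \<ge> ln (real (n + m + 1) / real (n + 1))"
proof (induction m)
  case (Suc m)
  have "ln (real (n + m + 2) / real (n + m + 1)) \<le> 1 / real (n + m + 1)"
    using ln_le_minus_one[of "real (n + m + 2) / real (n + m + 1)"] by (simp add: field_simps)
  with Suc show ?case by (simp add: ln_div algebra_simps)
qed simp

theorem theorem2p1:
  fixes M :: "'r measure"
    and A :: "'r \<Rightarrow> nat set list \<Rightarrow> nat set set"
  assumes "randomized_preemptive_online_algorithm M A"
  shows "competitive_ratio M A \<ge> ereal (1 + ln 2) \<and>
         (\<forall>C::real. C \<ge> 1 \<and> competitive M A C \<longrightarrow> C \<ge> 1 + ln 2)"
proof -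
  have bound: "1 + ln 2 \<le> C" if C: "1 \<le> C" "competitive M A C" for C
  proof (rule LIMSEQ_le_const2)
    show "(\<lambda>n. (1 + ln (real (n + n + 1) / real (n + 1))) * (real n / real (Suc n)))
        \<longlonglongrightarrow> 1 + ln 2"
      by real_asymp
    show "\<exists>N. \<forall>n\<ge>N. (1 + ln (real (n + n + 1) / real (n + 1))) * (real n / real (Suc n)) \<le> C"
    proof (intro exI[of _ 1] allI impI)
      fix n :: nat assume "1 \<le> n"
      have "(1 + ln (real (n + n + 1) / real (n + 1))) * (real n / real (Suc n))
          \<le> (1 + (\<Sum>i=1..n. 1 / real (n + i))) * (real n / real (Suc n))"
        using harmonic_block_ge[of n n] by (intro mult_right_mono) auto
      also have "\<dots> \<le> C" using competitive_bound[OF assms C] \<open>1 \<le> n\<close> by simp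
      finally show "(1 + ln (real (n + n + 1) / real (n + 1))) * (real n / real (Suc n)) \<le> C" .
    qed
  qed
  \<comment> \<open>\<open>Inf_greatest\<close> also covers an algorithm with no admissible
    \<open>C\<close>, whose ratio is infinite.\<close>
  thus ?thesis unfolding competitive_ratio_def by (auto intro!: Inf_greatest)
qed

end
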